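(* Let $n\ge2$ and let $\Pi=e^{P_h/2}+e^{-P_h/2}$ be any non-zero parameter. Express the matrices $\mathcal G^{(k)}$ through the elements $\hat G_{i,j}$ of the $D_n$ algebra and $\Pi$ by $\mathcal A^{(0)}=\hat{\mathcal A}$ and, for $k\ge1$, $$\mathcal G^{(k)}=\frac{e^{kP_h}-e^{-kP_h}}{e^{P_h}-e^{-P_h}}\hat{\mathcal R}+\frac{e^{kP_h}-2+e^{-kP_h}}{(e^{P_h}-1)(1-e^{-P_h})}\hat{\mathcal S}+\left[\frac{e^{kP_h}}{1-e^{-P_h}}-\frac{e^{-kP_h}}{e^{P_h}-1}\right]\hat{\mathcal A}-\left[\frac{e^{(k-1)P_h}}{1-e^{-P_h}}-\frac{e^{-(k-1)P_h}}{e^{P_h}-1}\right]\hat{\mathcal A}^T .$$ Then the expressions $$\beta_{i,i+1}\mathcal G(\lambda)=B_{i,i+1}\mathcal G(\lambda)B_{i,i+1}^T\ (1\le i\le n-1),\qquad \beta_{n,1}\mathcal G(\lambda)=B_{n,1}(\lambda)\mathcal G(\lambda)\bigl(B_{n,1}(\lambda^{-1})\bigr)^T,$$ with $\mathcal G(\lambda)=\mathcal A^{(0)}+\sum_{k\ge1}\mathcal G^{(k)}\lambda^{-k}$, are faithful representations for the braid-group action on the elements $\hat G_{i,j}$ of the $D_n$ algebra: performing these matrix transformations on the so-expressed $\mathcal G(\lambda)$ yields, in each matrix entry, the same expression with every $\hat G_{i,j}$ replaced by its image $\tilde{\hat G}_{i,j}$ under the $D_n$ braid transformation ($\Pi$ being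 unchanged).
   Context: $D_n$ elements: $n^2$ formal commuting variables $\hat G_{i,j}$, $1\le i,j\le n$. Matrices: $\hat{\mathcal A}$ is upper triangular with $\hat{\mathcal A}_{i,j}=\hat G_{i,j}$ for $i<j$ and $1$ on the diagonal; $\hat{\mathcal S}_{i,j}=\hat G_{i,i}\hat G_{j,j}$; $\hat{\mathcal R}$ is skew-symmetric with $\hat{\mathcal R}_{i,j}=\hat G_{j,i}+\hat G_{i,j}-\hat G_{i,i}\hat G_{j,j}$ for $j<i$ and $\hat{\mathcal R}_{i,j}=-\hat G_{j,i}-\hat G_{i,j}+\hat G_{i,i}\hat G_{j,j}$ for $j>i$. The coefficients in the formula for $\mathcal G^{(k)}$ are Laurent polynomials in $e^{P_h}$, which is how they are read if $e^{P_h}=1$. $B_{i,i+1}$ is the identity except for the block $\begin{pmatrix}\hat G_{i,i+1}&-1\\1&0\end{pmatrix}$ in rows/columns $i,i+1$ (here $G^{(0)}_{i,i+1}=\hat G_{i,i+1}$); $B_{n,1}(\lambda)$ has entries $(1,n)\mapsto\lambda$, $(n,1)\mapsto-\lambda^{-1}$, $(n,n)\mapsto G^{(1)}_{n,1}=\hat G_{n,1}$, $(j,j)\mapsto1$ for $1<j<n$, zeros elsewhere. $D_n$ braid action. $\beta_{i,i+1}$, $1\le i\le n-1$: for $k\ne i,i+1$: $\tilde{\hat G}_{i+1,k}=\hat G_{i,k}$, $\tilde{\hat G}_{i,k}=\hat G_{i,k}\hat G_{i,i+1}-\hat G_{i+1,k}$, $\tilde{\hat G}_{k,i+1}=\hat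 G_{k,i}$, $\tilde{\hat G}_{k,i}=\hat G_{k,i}\hat G_{i,i+1}-\hat G_{k,i+1}$; and $\tilde{\hat G}_{i,i+1}=\hat G_{i,i+1}$, $\tilde{\hat G}_{i+1,i+1}=\hat G_{i,i}$, $\tilde{\hat G}_{i,i}=\hat G_{i,i}\hat G_{i,i+1}-\hat G_{i+1,i+1}$, $\tilde{\hat G}_{i+1,i}=\hat G_{i+1,i}+\hat G_{i,i+1}\hat G_{i,i}^2-2\hat G_{i,i}\hat G_{i+1,i+1}$. $\beta_{n,1}$: for $k\ne n,1$: $\tilde{\hat G}_{1,k}=\hat G_{n,k}$, $\tilde{\hat G}_{n,k}=\hat G_{n,k}\hat G_{n,1}-\hat G_{1,k}$, $\tilde{\hat G}_{k,1}=\hat G_{k,n}$, $\tilde{\hat G}_{k,n}=\hat G_{k,n}\hat G_{n,1}-\hat G_{k,1}$; and $\tilde{\hat G}_{n,1}=\hat G_{n,1}$, $\tilde{\hat G}_{1,1}=\hat G_{n,n}$, $\tilde{\hat G}_{n,n}=\hat G_{n,n}\hat G_{n,1}-\hat G_{1,1}$, $\tilde{\hat G}_{1,n}=\hat G_{1,n}+\hat G_{n,1}\hat G_{n,n}^2-2\hat G_{n,n}\hat G_{1,1}$. All other variables are unchanged. *)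

theory Defs
  imports
    Complex_Main
    "HOL-Library.Poly_Mapping"
    "HOL-Computational_Algebra.Formal_Laurent_Series"
    "Jordan_Normal_Form.Matrix"
begin

section \<open>The algebra of the formal variables\<close>

text \<open>
  Polynomials with complex coefficients in commuting variables indexed by pairs of natural
  numbers. For a given \<open>n\<close> only the \<open>n\<^sup>2\<close> variables with indices in \<open>{1..n}\<close> occur in the
  matrices below, and the braid transformations fix all others. Indices are 1-based.
\<close>

type_synonym dn = "((nat \<times> nat) \<Rightarrow>\<^sub>0 nat) \<Rightarrow>\<^sub>0 complex"

definition const_dn :: "complex \<Rightarrow> dn" where
  "const_dn c = Poly_Mapping.single 0 c"

definition G :: "nat \<Rightarrow> nat \<Rightarrow> dn" where
  "G i j = Poly_Mapping.single (Poly_Mapping.single (i, j) 1) 1"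

definition subst_dn :: "(nat \<Rightarrow> nat \<Rightarrow> dn) \<Rightarrow> dn \<Rightarrow> dn" where
  "subst_dn \<sigma> p = (\<Sum>m\<in>Poly_Mapping.keys p. const_dn (Poly_Mapping.lookup p m) *
     (\<Prod>(i, j)\<in>Poly_Mapping.keys m. \<sigma> i j ^ Poly_Mapping.lookup m (i, j)))"

text \<open>The following facts say that \<^const>\<open>subst_dn\<close> is the unital \<open>\<complex>\<close>-algebra endomorphism
  that sends each variable to its prescribed image.\<close>

lemma const_dn_0 [simp]: "const_dn 0 = 0"
  by (simp add: const_dn_def)

lemma const_dn_add: "const_dn (a + b) = const_dn a + const_dn b"
  by (simp add: const_dn_def single_add)

lemma const_dn_mult: "const_dn (a * b) = const_dn a * const_dn b"
  by (simp add: const_dn_def mult_single)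

lemma const_dn_1 [simp]: "const_dn 1 = 1"
  by (simp add: const_dn_def)

lemma subst_dn_const [simp]: "subst_dn \<sigma> (const_dn c) = const_dn c"
  by (cases "c = 0") (simp_all add: subst_dn_def const_dn_def mult_single)

lemma subst_dn_G [simp]: "subst_dn \<sigma> (G i j) = \<sigma> i j"
  by (simp add: subst_dn_def G_def)

lemma subst_dn_superset:
  assumes "finite S" "Poly_Mapping.keys p \<subseteq> S"
  shows "subst_dn \<sigma> p = (\<Sum>m\<in>S. const_dn (Poly_Mapping.lookup p m) *
     (\<Prod>(i, j)\<in>Poly_Mapping.keys m. \<sigma> i j ^ Poly_Mapping.lookup m (i, j)))"
  unfolding subst_dn_def
  by (rule sum.mono_neutral_left) (use assms in \<open>auto simp: in_keys_iff\<close>)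

lemma subst_dn_add: "subst_dn \<sigma> (p + q) = subst_dn \<sigma> p + subst_dn \<sigma> q"
proof -
  let ?S = "Poly_Mapping.keys p \<union> Poly_Mapping.keys q"
  have "Poly_Mapping.keys (p + q) \<subseteq> ?S"
    by (rule keys_add)
  then show ?thesis
    by (simp add: subst_dn_superset[of ?S] lookup_add const_dn_add distrib_right sum.distrib)
qed

lemma subst_dn_0 [simp]: "subst_dn \<sigma> 0 = 0"
  by (simp add: subst_dn_def)

lemma subst_dn_sum: "subst_dn \<sigma> (sum f A) = (\<Sum>x\<in>A. subst_dn \<sigma> (f x))"
  by (induction A rule: infinite_finite_induct) (simp_all add: subst_dn_add)

lemma prod_keys_superset:
  fixes \<sigma> :: "nat \<Rightarrow> nat \<Rightarrow> dn"
  assumes "finite S" "Poly_Mapping.keys m \<subseteq> S"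
  shows "(\<Prod>(i, j)\<in>Poly_Mapping.keys m. \<sigma> i j ^ Poly_Mapping.lookup m (i, j)) =
    (\<Prod>(i, j)\<in>S. \<sigma> i j ^ Poly_Mapping.lookup m (i, j))"
  by (rule prod.mono_neutral_left) (use assms in \<open>auto simp: in_keys_iff\<close>)

lemma subst_dn_single:
  "subst_dn \<sigma> (Poly_Mapping.single m c) = const_dn c *
     (\<Prod>(i, j)\<in>Poly_Mapping.keys m. \<sigma> i j ^ Poly_Mapping.lookup m (i, j))"
  by (cases "c = 0") (simp_all add: subst_dn_def)

lemma subst_dn_single_mult:
  "subst_dn \<sigma> (Poly_Mapping.single m c * Poly_Mapping.single l d) =
   subst_dn \<sigma> (Poly_Mapping.single m c) * subst_dn \<sigma> (Poly_Mapping.single l d)"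
proof -
  let ?S = "Poly_Mapping.keys m \<union> Poly_Mapping.keys l"
  have "Poly_Mapping.keys (m + l) \<subseteq> ?S"
    by (rule keys_add)
  then have eq: "(\<Prod>(i, j)\<in>Poly_Mapping.keys k. \<sigma> i j ^ Poly_Mapping.lookup k (i, j)) =
      (\<Prod>(i, j)\<in>?S. \<sigma> i j ^ Poly_Mapping.lookup k (i, j))" if "k \<in> {m, l, m + l}" for k
    using that by (intro prod_keys_superset) auto
  have *: "(\<Prod>(i, j)\<in>?S. \<sigma> i j ^ Poly_Mapping.lookup (m + l) (i, j)) =
      (\<Prod>(i, j)\<in>?S. \<sigma> i j ^ Poly_Mapping.lookup m (i, j)) *
      (\<Prod>(i, j)\<in>?S. \<sigma> i j ^ Poly_Mapping.lookup l (i, j))"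
    by (simp add: lookup_add power_add case_prod_unfold prod.distrib)
  have "subst_dn \<sigma> (Poly_Mapping.single m c * Poly_Mapping.single l d) =
      const_dn (c * d) * (\<Prod>(i, j)\<in>?S. \<sigma> i j ^ Poly_Mapping.lookup (m + l) (i, j))"
    using eq[of "m + l"] by (simp add: mult_single subst_dn_single)
  also have "\<dots> = subst_dn \<sigma> (Poly_Mapping.single m c) * subst_dn \<sigma> (Poly_Mapping.single l d)"
    using eq[of m] eq[of l] by (simp add: * subst_dn_single const_dn_mult mult.assoc mult.left_commute[of "const_dn d"])
  finally show ?thesis .
qed

lemma sum_single_lookup:
  fixes p :: dn
  shows "p = (\<Sum>m\<in>Poly_Mapping.keys p. Poly_Mapping.single m (Poly_Mapping.lookup p m))"
  by (rule poly_mapping_eqI)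
     (simp add: lookup_sum lookup_single when_def in_keys_iff)

lemma subst_dn_mult: "subst_dn \<sigma> (p * q) = subst_dn \<sigma> p * subst_dn \<sigma> q"
proof -
  let ?s = "\<lambda>p m. Poly_Mapping.single m (Poly_Mapping.lookup p m) :: dn"
  have "p * q = (\<Sum>m\<in>Poly_Mapping.keys p. \<Sum>l\<in>Poly_Mapping.keys q. ?s p m * ?s q l)"
    by (subst (1) sum_single_lookup[of p], subst (1) sum_single_lookup[of q]) (rule sum_product)
  then have "subst_dn \<sigma> (p * q) =
      (\<Sum>m\<in>Poly_Mapping.keys p. subst_dn \<sigma> (?s p m)) *
      (\<Sum>l\<in>Poly_Mapping.keys q. subst_dn \<sigma> (?s q l))"
    by (simp add: subst_dn_sum subst_dn_single_mult sum_product)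
  also have "\<dots> = subst_dn \<sigma> p * subst_dn \<sigma> q"
    by (simp flip: subst_dn_sum sum_single_lookup)
  finally show ?thesis .
qed


section \<open>The coefficients\<close>

text \<open>
  The coefficients are quotients of Laurent polynomials in \<open>q = exp P\<close> that are again Laurent
  polynomials; this is the meaning at \<open>q = 1\<close>, where the written quotients are \<open>0 / 0\<close>.
  The lemmas \<open>laurR_mult\<close>, \<open>laurS_mult\<close>, \<open>laurA_mult\<close> verify these Laurent polynomials.
\<close>

definition laurR :: "complex \<Rightarrow> nat \<Rightarrow> complex" where
  "laurR q k = (\<Sum>j<k. q powi (int k - 1 - 2 * int j))"

definition laurS :: "complex \<Rightarrow> nat \<Rightarrow> complex" where
  "laurS q k = q powi (1 - int k) * (\<Sum>j<k. q ^ j)\<^sup>2"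

definition laurA :: "complex \<Rightarrow> nat \<Rightarrow> complex" where
  "laurA q k = (\<Sum>m\<in>{- int k..int k}. q powi m)"

definition coeffR :: "complex \<Rightarrow> nat \<Rightarrow> complex" where
  "coeffR P k = (if exp P = 1 then laurR (exp P) k
     else (exp (of_nat k * P) - exp (- of_nat k * P)) / (exp P - exp (- P)))"

definition coeffS :: "complex \<Rightarrow> nat \<Rightarrow> complex" where
  "coeffS P k = (if exp P = 1 then laurS (exp P) k
     else (exp (of_nat k * P) - 2 + exp (- of_nat k * P)) / ((exp P - 1) * (1 - exp (- P))))"

definition coeffA :: "complex \<Rightarrow> nat \<Rightarrow> complex" where
  "coeffA P k = (if exp P = 1 then laurA (exp P) k
     else exp (of_nat k * P) / (1 - exp (- P)) - exp (- of_nat k * P) / (exp P - 1))"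

lemma laurR_mult:
  assumes "q \<noteq> 0"
  shows "laurR q k * (q - inverse q) = q ^ k - inverse q ^ k"
proof -
  have *: "laurR q k = q powi (1 - int k) * (\<Sum>j<k. (q\<^sup>2) ^ j)"
  proof -
    have "laurR q k = (\<Sum>j<k. q powi (int k - 1 - 2 * int (k - Suc j)))"
      unfolding laurR_def by (rule sum.nat_diff_reindex[symmetric])
    also have "\<dots> = (\<Sum>j<k. q powi (1 - int k) * (q\<^sup>2) ^ j)"
    proof (rule sum.cong[OF refl])
      fix j assume "j \<in> {..<k}"
      then have "int k - 1 - 2 * int (k - Suc j) = (1 - int k) + int (2 * j)"
        by (simp add: of_nat_diff)
      then show "q powi (int k - 1 - 2 * int (k - Suc j)) = q powi (1 - int k) * (q\<^sup>2) ^ j"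
        using assms by (simp only: power_int_add power_int_of_nat power_mult simp_thms)
    qed
    finally show ?thesis by (simp add: sum_distrib_left)
  qed
  have "laurR q k * (q - inverse q) = q powi (1 - int k) * inverse q * ((q\<^sup>2 - 1) * (\<Sum>j<k. (q\<^sup>2) ^ j))"
    using assms by (simp add: * field_simps power2_eq_square)
  also have "\<dots> = q powi (1 - int k) * inverse q * ((q\<^sup>2) ^ k - 1)"
    by (simp flip: power_diff_1_eq)
  also have "\<dots> = q ^ k - inverse q ^ k"
    using assms by (simp add: power_int_diff field_simps power2_eq_square power_mult_distrib)
  finally show ?thesis .
qed

lemma laurS_mult:
  assumes "q \<noteq> 0"
  shows "laurS q k * ((q - 1) * (1 - inverse q)) = q ^ k - 2 + inverse q ^ k"
proof -
  have "laurS q k * ((q - 1) * (1 - inverse q)) =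
      q powi (1 - int k) * inverse q * ((q - 1) * (\<Sum>j<k. q ^ j))\<^sup>2"
    using assms by (simp add: laurS_def field_simps power2_eq_square)
  also have "\<dots> = q powi (1 - int k) * inverse q * (q ^ k - 1)\<^sup>2"
    by (simp flip: power_diff_1_eq)
  also have "\<dots> = q ^ k - 2 + inverse q ^ k"
    using assms by (simp add: power_int_diff field_simps power2_eq_square)
  finally show ?thesis .
qed

lemma laurA_mult:
  assumes "q \<noteq> 0"
  shows "laurA q k * (q - 1) = q ^ k * q - inverse q ^ k"
proof (induction k)
  case 0
  then show ?case by (simp add: laurA_def)
next
  case (Suc k)
  have "{- int (Suc k)..int (Suc k)} = insert (- int (Suc k)) (insert (int (Suc k)) {- int k..int k})"
    by auto
  then have "laurA q (Suc k) = inverse q ^ Suc k + q ^ Suc k + laurA q k"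
    by (simp add: laurA_def power_int_minus power_inverse del: of_nat_Suc power_Suc)
  then have "laurA q (Suc k) * (q - 1)
      = (inverse q ^ Suc k + q ^ Suc k) * (q - 1) + (q ^ k * q - inverse q ^ k)"
    using Suc.IH by (simp only: distrib_right)
  also have "\<dots> = q ^ Suc k * q - inverse q ^ Suc k"
    using assms by (simp add: field_simps)
  finally show ?case .
qed


section \<open>The matrices\<close>

definition mat1 :: "nat \<Rightarrow> (nat \<Rightarrow> nat \<Rightarrow> 'a) \<Rightarrow> 'a mat" where
  "mat1 n f = mat n n (\<lambda>(i, j). f (i + 1) (j + 1))"

definition A_hat :: "nat \<Rightarrow> dn mat" where
  "A_hat n = mat1 n (\<lambda>i j. if i < j then G i j else if i = j then 1 else 0)"

definition S_hat :: "nat \<Rightarrow> dn mat" where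
  "S_hat n = mat1 n (\<lambda>i j. G i i * G j j)"

definition R_hat :: "nat \<Rightarrow> dn mat" where
  "R_hat n = mat1 n (\<lambda>i j.
     if j < i then G j i + G i j - G i i * G j j
     else if i < j then - G j i - G i j + G i i * G j j
     else 0)"

text \<open>For \<open>k = 0\<close> this is the leading term of the generating series.\<close>

definition G_level :: "nat \<Rightarrow> complex \<Rightarrow> nat \<Rightarrow> dn mat" where
  "G_level n P k = (if k = 0 then A_hat n
     else const_dn (coeffR P k) \<cdot>\<^sub>m R_hat n + const_dn (coeffS P k) \<cdot>\<^sub>m S_hat n
       + const_dn (coeffA P k) \<cdot>\<^sub>m A_hat n
       - const_dn (coeffA P (k - 1)) \<cdot>\<^sub>m transpose_mat (A_hat n))"

text \<open>
  Formal Laurent series are taken in \<open>\<lambda>\<^sup>-\<^sup>1\<close>, so \<^const>\<open>fls_X\<close> stands for \<open>\<lambda>\<^sup>-\<^sup>1\<close> and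
  \<open>lam e\<close> for \<open>\<lambda>\<^sup>e\<close>.
\<close>

definition lam :: "int \<Rightarrow> dn fls" where
  "lam e = fls_X_intpow (- e)"

definition G_series :: "nat \<Rightarrow> complex \<Rightarrow> dn fls mat" where
  "G_series n P = mat n n (\<lambda>ij. fps_to_fls (Abs_fps (\<lambda>k. index_mat (G_level n P k) ij)))"

definition B_mat :: "nat \<Rightarrow> nat \<Rightarrow> dn fls mat" where
  "B_mat n i = mat1 n (\<lambda>a b.
     if a = i \<and> b = i then fls_const (G i (i + 1))
     else if a = i \<and> b = i + 1 then - 1
     else if a = i + 1 \<and> b = i then 1
     else if a = i + 1 \<and> b = i + 1 then 0
     else if a = b then 1 else 0)"

text \<open>\<open>B_cyc n e\<close> is the matrix \<open>B\<close> for the pair \<open>n, 1\<close> at the argument \<open>\<lambda>\<^sup>e\<close>.\<close>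

definition B_cyc :: "nat \<Rightarrow> int \<Rightarrow> dn fls mat" where
  "B_cyc n e = mat1 n (\<lambda>a b.
     if a = 1 \<and> b = n then lam e
     else if a = n \<and> b = 1 then - lam (- e)
     else if a = n \<and> b = n then fls_const (G n 1)
     else if a = b \<and> 1 < a \<and> a < n then 1 else 0)"


section \<open>The braid transformations\<close>

text \<open>
  The transformations for \<open>i, i + 1\<close> and for \<open>n, 1\<close> are given by the same formulas,
  with \<open>(p, q) = (i, i + 1)\<close> and \<open>(p, q) = (n, 1)\<close> respectively.
\<close>

definition braid_image :: "nat \<Rightarrow> nat \<Rightarrow> nat \<Rightarrow> nat \<Rightarrow> nat \<Rightarrow> dn" where
  "braid_image n p q a b =
    (if a \<notin> {1..n} \<or> b \<notin> {1..n} then G a b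
     else if a = p \<and> b = q then G p q
     else if a = q \<and> b = q then G p p
     else if a = p \<and> b = p then G p p * G p q - G q q
     else if a = q \<and> b = p then G q p + G p q * (G p p)\<^sup>2 - 2 * G p p * G q q
     else if a = q then G p b
     else if a = p then G p b * G p q - G q b
     else if b = q then G a p
     else if b = p then G a p * G p q - G a q
     else G a b)"

definition map_coeffs :: "(dn \<Rightarrow> dn) \<Rightarrow> dn fls \<Rightarrow> dn fls" where
  "map_coeffs f F = Abs_fls (\<lambda>k. f (fls_nth F k))"

lemma nth_map_coeffs:
  assumes "f 0 = 0"
  shows "fls_nth (map_coeffs f F) k = f (fls_nth F k)"
proof -
  have "\<forall>\<^sub>\<infinity>m. f (fls_nth F (- int m)) = 0"
    using MOST_fls_neg_nth_eq_0[of F] by (rule eventually_mono) (simp add: assms)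
  then show ?thesis by (simp add: map_coeffs_def)
qed

definition braid_act :: "nat \<Rightarrow> nat \<Rightarrow> nat \<Rightarrow> dn fls mat \<Rightarrow> dn fls mat" where
  "braid_act n p q M = map_mat (map_coeffs (subst_dn (braid_image n p q))) M"

end

theory Submission
  imports Defs
begin

text \<open>
  Write \<open>t = \<lambda>\<^sup>-\<^sup>1\<close>, and let \<open>r\<^sub>k, s\<^sub>k, a\<^sub>k\<close> be the coefficients of \<open>R\<close>, \<open>S\<close>, \<open>A\<close> at level \<open>k\<close>, so
  that \<open>A\<^sup>T\<close> has the coefficient \<open>- a\<^bsub>k-1\<^esub>\<close>. They satisfy \<open>r\<^bsub>k+1\<^esub> + r\<^sub>k = a\<^sub>k = s\<^bsub>k+1\<^esub> - s\<^sub>k\<close> with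
  \<open>r\<^sub>0 = s\<^sub>0 = 0\<close> (\<open>coeff_recurrence\<close>); the assumption on the parameter enters here, as it
  excludes \<open>exp P = - 1\<close>. Hence a single scalar series \<open>h = \<Sum> (r\<^sub>k + s\<^sub>k) / 2 t\<^sup>k\<close> determines all three:
  the series of \<open>r\<close> and \<open>s\<close> are \<open>(1 - t) h\<close> and \<open>(1 + t) h\<close>, and that of \<open>a\<close> is \<open>\<lambda> (1 - t\<^sup>2) h\<close>
  (\<open>level_factor_series\<close>). Thus \<open>G(\<lambda>) = h K(\<lambda>)\<close> with a matrix \<open>K\<close> of Laurent polynomials in
  \<open>\<lambda>\<close> that does not contain \<open>P\<close> (\<open>G_series_factorisation\<close>):
  \<open>K\<^sub>a\<^sub>a = (1 + t) G\<^sub>a\<^sub>a\<^sup>2 + (\<lambda> - 1) (1 - t\<^sup>2)\<close>, and for \<open>a \<noteq> b\<close>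
  \<open>K\<^sub>a\<^sub>b = e\<^sub>a\<^sub>b (2 G\<^sub>a\<^sub>a G\<^sub>b\<^sub>b + (\<lambda> - 1) G\<^sub>a\<^sub>b - (1 - t) G\<^sub>b\<^sub>a)\<close> with \<open>e\<^sub>a\<^sub>b = 1\<close> above the diagonal and
  \<open>e\<^sub>a\<^sub>b = t\<close> below it.

  The substitution fixes \<open>h\<close> and multiplication by matrices is linear, so the claim reduces to
  the one for \<open>K\<close>. There the order of the indices enters only through the weights \<open>e\<close>. Replacing the index
  \<open>i\<close> by \<open>i + 1\<close> leaves the weights against all other indices unchanged; replacing \<open>n\<close> by \<open>1\<close>
  multiplies them by \<open>\<lambda>\<close> or \<open>\<lambda>\<^sup>-\<^sup>1\<close>, and this is what the entries \<open>\<lambda>\<close> and \<open>- \<lambda>\<^sup>-\<^sup>1\<close> of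
  \<open>B\<^bsub>n,1\<^esub>(\<lambda>)\<close> compensate. Both kinds of generators are therefore instances of one identity in a
  commutative ring (\<open>braid_kernel_braid_move\<close>), with mutually inverse scalars \<open>c, d\<close> equal to
  \<open>1, 1\<close> or to \<open>\<lambda>, \<lambda>\<^sup>-\<^sup>1\<close>.
\<close>

section \<open>The universal kernel\<close>

text \<open>
  Over an arbitrary commutative ring, with \<open>l\<close> for \<open>\<lambda>\<close> and \<open>t\<close> for \<open>\<lambda>\<^sup>-\<^sup>1\<close>; the weight \<open>e\<close> is kept
  abstract so that the adjacent pairs and the pair \<open>n, 1\<close> can be treated alike.
\<close>

definition braid_kernel ::
    "'a::comm_ring_1 \<Rightarrow> 'a \<Rightarrow> (nat \<Rightarrow> nat \<Rightarrow> 'a) \<Rightarrow> (nat \<Rightarrow> nat \<Rightarrow> 'a) \<Rightarrow> nat \<Rightarrow> nat \<Rightarrow> 'a" where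
  "braid_kernel t l e x a b =
    (if a = b then (1 + t) * (x a a)\<^sup>2 + (l - 1) * (1 - t\<^sup>2)
     else e a b * (2 * x a a * x b b + (l - 1) * x a b - (1 - t) * x b a))"

text \<open>
  The formulas of \<^const>\<open>braid_image\<close> inside the index range, for elements \<open>x a b\<close> of any
  commutative ring in place of the variables.
\<close>

definition braid_move :: "nat \<Rightarrow> nat \<Rightarrow> (nat \<Rightarrow> nat \<Rightarrow> 'a::comm_ring_1) \<Rightarrow> nat \<Rightarrow> nat \<Rightarrow> 'a" where
  "braid_move p q x a b =
    (if a = p \<and> b = q then x p q
     else if a = q \<and> b = q then x p p
     else if a = p \<and> b = p then x p p * x p q - x q q
     else if a = q \<and> b = p then x q p + x p q * (x p p)\<^sup>2 - 2 * x p p * x q q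
     else if a = q then x p b
     else if a = p then x p b * x p q - x q b
     else if b = q then x a p
     else if b = p then x a p * x p q - x a q
     else x a b)"

text \<open>
  The effect on a vector of the matrix that is the identity except for the block with rows
  \<open>(g, - d)\<close> and \<open>(c, 0)\<close> at the indices \<open>p, q\<close>.
\<close>

definition pair_row :: "nat \<Rightarrow> nat \<Rightarrow> 'a::comm_ring_1 \<Rightarrow> 'a \<Rightarrow> 'a \<Rightarrow> (nat \<Rightarrow> 'a) \<Rightarrow> nat \<Rightarrow> 'a" where
  "pair_row p q g c d v a = (if a = p then g * v p - d * v q else if a = q then c * v p else v a)"

lemma pair_row_scale: "pair_row p q g c d (\<lambda>k. h * v k) a = h * pair_row p q g c d v a"
  by (simp add: pair_row_def algebra_simps)

lemma mult_left_cancel_inverse: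
  fixes a b :: "'a::comm_ring_1"
  assumes "a * b = 1"
  shows "a * (b * z) = z" and "b * (a * z) = z"
  using assms by (simp_all add: mult.commute[of a b] flip: mult.assoc)

text \<open>
  The conditions on \<open>e\<close> say that passing from \<open>p\<close> to \<open>q\<close> rescales the weights against all
  other indices by \<open>c\<close> in rows and by \<open>d\<close> in columns. These factors cancel against the
  scalars in the row operation. When both indices lie in \<open>{p, q}\<close>, the quadratic correction in the image
  of \<open>x q p\<close> cancels the products of diagonal entries, and the constant \<open>(l - 1) (1 - t\<^sup>2)\<close> on
  the diagonal is exactly what restores the terms linear in \<open>x p q\<close>.
\<close>

lemma braid_kernel_braid_move:
  fixes t l c d :: "'a::comm_ring_1"
  assumes tl: "t * l = 1" and cd: "c * d = 1" and pq: "p \<noteq> q"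
    and e_pq: "e p q = d" and e_qp: "e q p = t * c"
    and e_row: "b \<noteq> p \<Longrightarrow> b \<noteq> q \<Longrightarrow> e q b = c * e p b"
    and e_col: "a \<noteq> p \<Longrightarrow> a \<noteq> q \<Longrightarrow> e a q = d * e a p"
  shows "braid_kernel t l e (braid_move p q x) a b =
    pair_row p q (x p q) c d (\<lambda>a'. pair_row p q (x p q) d c (braid_kernel t l e x a') b) a"
proof -
  note cancel = mult_left_cancel_inverse[OF tl] mult_left_cancel_inverse[OF cd]
  note expand = braid_kernel_def braid_move_def pair_row_def
  note norm = algebra_simps power2_eq_square cancel tl cd
  have qp: "q \<noteq> p"
    using pq by simp
  consider "a = p" "b = p" | "a = p" "b = q" | "a = q" "b = p" | "a = q" "b = q"
    | "a = p" "b \<noteq> p" "b \<noteq> q" | "a = q" "b \<noteq> p" "b \<noteq> q"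
    | "a \<noteq> p" "a \<noteq> q" "b = p" | "a \<noteq> p" "a \<noteq> q" "b = q"
    | "a \<noteq> p" "a \<noteq> q" "b \<noteq> p" "b \<noteq> q"
    by blast
  then show ?thesis
  proof cases
    case 1 then show ?thesis using pq qp by (simp add: expand e_pq e_qp; simp add: norm)
  next
    case 2 then show ?thesis using pq qp by (simp add: expand e_pq e_qp; simp add: norm)
  next
    case 3 then show ?thesis using pq qp by (simp add: expand e_pq e_qp; simp add: norm)
  next
    case 4 then show ?thesis using pq qp by (simp add: expand e_pq e_qp; simp add: norm)
  next
    case 5 then show ?thesis using pq qp by (simp add: expand e_row; simp add: norm)
  next
    case 6 then show ?thesis using pq qp by (simp add: expand e_row; simp add: norm)
  next
    case 7 then show ?thesis using pq qp by (simp add: expand e_col; simp add: norm)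
  next
    case 8 then show ?thesis using pq qp by (simp add: expand e_col; simp add: norm)
  next
    case 9 then show ?thesis using pq qp by (simp add: expand)
  qed
qed

section \<open>Matrices acting on one pair of rows\<close>

definition pair_entry :: "nat \<Rightarrow> nat \<Rightarrow> 'a::comm_ring_1 \<Rightarrow> 'a \<Rightarrow> 'a \<Rightarrow> nat \<Rightarrow> nat \<Rightarrow> 'a" where
  "pair_entry p q g c d a b =
    (if a = p then if b = p then g else if b = q then - d else 0
     else if a = q then if b = p then c else 0
     else if b = a then 1 else 0)"

text \<open>
  For \<open>c = d = 1\<close> and \<open>(p, q) = (i, i + 1)\<close> this is \<^const>\<open>B_mat\<close>; for \<open>c = \<lambda>\<close>, \<open>d = \<lambda>\<^sup>-\<^sup>1\<close> and
  \<open>(p, q) = (n, 1)\<close> it is \<^const>\<open>B_cyc\<close>. Replacing \<open>\<lambda>\<close> by \<open>\<lambda>\<^sup>-\<^sup>1\<close> exchanges \<open>c\<close> and \<open>d\<close>.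
\<close>

definition pair_mat :: "nat \<Rightarrow> nat \<Rightarrow> nat \<Rightarrow> 'a::comm_ring_1 \<Rightarrow> 'a \<Rightarrow> 'a \<Rightarrow> 'a mat" where
  "pair_mat n p q g c d = mat1 n (pair_entry p q g c d)"

lemma mat1_cong:
  assumes "\<And>a b. a \<in> {1..n} \<Longrightarrow> b \<in> {1..n} \<Longrightarrow> f a b = h a b"
  shows "mat1 n f = mat1 n h"
  using assms by (auto simp: mat1_def intro!: cong_mat)

lemma transpose_mat1: "transpose_mat (mat1 n f) = mat1 n (\<lambda>a b. f b a)"
  by (auto simp: mat1_def transpose_mat_def intro!: cong_mat)

lemma mat1_mult:
  fixes f h :: "nat \<Rightarrow> nat \<Rightarrow> 'a::comm_ring_1"
  shows "mat1 n f * mat1 n h = mat1 n (\<lambda>a b. \<Sum>k=1..n. f a k * h k b)"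
proof -
  have "(\<Sum>k=1..n. f a k * h k b) = (\<Sum>k=0..<n. f a (k + 1) * h (k + 1) b)" for a b
    using sum.shift_bounds_Suc_ivl[of "\<lambda>k. f a k * h k b" 0 n]
    by (simp add: atLeastLessThanSuc_atLeastAtMost)
  then show ?thesis
    by (intro eq_matI) (auto simp: mat1_def scalar_prod_def)
qed

lemma pair_row_conv_sum:
  fixes v :: "nat \<Rightarrow> 'a::comm_ring_1"
  assumes "p \<in> {1..n}" "q \<in> {1..n}" "p \<noteq> q" "a \<in> {1..n}"
  shows "(\<Sum>k=1..n. pair_entry p q g c d a k * v k) = pair_row p q g c d v a"
proof -
  have "pair_entry p q g c d a k * v k =
     (if a = p then (if k = p then g * v p else 0) - (if k = q then d * v q else 0)
      else if a = q then (if k = p then c * v p else 0)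
      else (if k = a then v a else 0))" for k
    using assms by (auto simp: pair_entry_def)
  then show ?thesis
    using assms by (simp add: pair_row_def sum_subtractf)
qed

lemma pair_mat_conjugate:
  fixes M :: "nat \<Rightarrow> nat \<Rightarrow> 'a::comm_ring_1"
  assumes "p \<in> {1..n}" "q \<in> {1..n}" "p \<noteq> q"
  shows "pair_mat n p q g c d * mat1 n M * transpose_mat (pair_mat n p q g d c) =
    mat1 n (\<lambda>a b. pair_row p q g c d (\<lambda>a'. pair_row p q g d c (M a') b) a)"
proof -
  have left: "pair_mat n p q g c d * mat1 n N = mat1 n (\<lambda>a b. pair_row p q g c d (\<lambda>k. N k b) a)" for N
    unfolding pair_mat_def mat1_mult by (rule mat1_cong) (rule pair_row_conv_sum[OF assms])
  have right: "mat1 n N * transpose_mat (pair_mat n p q g d c) = mat1 n (\<lambda>a b. pair_row p q g d c (N a) b)" for N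
    unfolding pair_mat_def mat1_mult transpose_mat1
    by (rule mat1_cong) (subst mult.commute, rule pair_row_conv_sum[OF assms])
  show ?thesis
    unfolding left right
    by (rule mat1_cong) (simp add: pair_row_def algebra_simps)
qed

section \<open>The coefficients\<close>

text \<open>
  The quotients over common denominators, in which \<open>z ^ k\<close> and its inverse occur linearly: the recurrences
  then only compare numerators.
\<close>

lemma coeff_closed_forms:
  fixes P :: complex
  defines "z \<equiv> exp P"
  assumes "z \<noteq> 1" "z \<noteq> - 1"
  shows "coeffR P k = z * (z ^ k - inverse z ^ k) / ((z - 1) * (z + 1))"
    and "coeffS P k = z * (z ^ k - 2 + inverse z ^ k) / (z - 1)\<^sup>2"
    and "coeffA P k = (z * z ^ k - inverse z ^ k) / (z - 1)"
proof -
  have z0: "z \<noteq> 0" and z1: "z - 1 \<noteq> 0" and z2: "z + 1 \<noteq> 0"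
    using assms by (auto simp: add_eq_0_iff2)
  have e: "exp (of_nat k * P) = z ^ k" "exp (- (of_nat k * P)) = inverse z ^ k" "exp (- P) = inverse z"
    by (simp_all add: z_def exp_of_nat_mult exp_minus power_inverse)
  have d: "z - inverse z = (z - 1) * (z + 1) / z" "1 - inverse z = (z - 1) / z"
    using z0 by (simp_all add: field_simps)
  show "coeffR P k = z * (z ^ k - inverse z ^ k) / ((z - 1) * (z + 1))"
    using assms by (simp add: coeffR_def e d flip: z_def)
  show "coeffS P k = z * (z ^ k - 2 + inverse z ^ k) / (z - 1)\<^sup>2"
    using assms by (simp add: coeffS_def e d power2_eq_square flip: z_def)
  show "coeffA P k = (z * z ^ k - inverse z ^ k) / (z - 1)"
  proof -
    have "coeffA P k = z ^ k / (1 - inverse z) - inverse z ^ k / (z - 1)"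
      using assms e by (simp only: coeffA_def z_def [symmetric] if_False mult_minus_left)
    also have "\<dots> = (z * z ^ k - inverse z ^ k) / (z - 1)"
      unfolding d by (simp add: mult.commute flip: diff_divide_distrib)
    finally show ?thesis .
  qed
qed

lemma laur_at_one:
  "laurR 1 k = of_nat k" "laurS 1 k = of_nat k ^ 2" "laurA 1 k = 2 * of_nat k + 1"
  by (simp_all add: laurR_def laurS_def laurA_def)

lemma coeff_initial: "coeffR P 0 = 0" "coeffS P 0 = 0" "coeffA P 0 = 1"
proof -
  show "coeffR P 0 = 0" "coeffS P 0 = 0"
    by (simp_all add: coeffR_def coeffS_def laurR_def laurS_def)
  show "coeffA P 0 = 1"
  proof (cases "exp P = 1")
    case True
    then show ?thesis by (simp add: coeffA_def laurA_def)
  next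
    case False
    have "1 - exp (- P) = (exp P - 1) / exp P"
      by (simp add: exp_minus field_simps)
    with False show ?thesis
      by (simp add: coeffA_def flip: diff_divide_distrib)
  qed
qed

text \<open>
  At \<open>exp P = 1\<close> the coefficients are \<open>k\<close>, \<open>k\<^sup>2\<close> and \<open>2 k + 1\<close>. At \<open>exp P = - 1\<close> the quotient
  for \<open>R\<close> has the denominator \<open>0\<close>, which is why that value is excluded.
\<close>

lemma coeff_recurrence:
  assumes "exp P \<noteq> - 1"
  shows "coeffA P k = coeffR P (Suc k) + coeffR P k"
    and "coeffS P (Suc k) = coeffS P k + coeffA P k"
proof -
  define z where "z = exp P"
  have "coeffA P k = coeffR P (Suc k) + coeffR P k \<and> coeffS P (Suc k) = coeffS P k + coeffA P k"
  proof (cases "z = 1")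
    case True
    then show ?thesis
      by (simp add: coeffR_def coeffS_def coeffA_def z_def laur_at_one power2_eq_square algebra_simps)
  next
    case False
    have z0: "z \<noteq> 0" and z1: "z - 1 \<noteq> 0" and z2: "z + 1 \<noteq> 0" and zm: "z \<noteq> - 1"
      using assms False by (auto simp: z_def add_eq_0_iff2)
    define u v where "u = z ^ k" and "v = inverse z ^ k"
    have s: "z ^ Suc k = z * u" "inverse z ^ Suc k = v / z"
      by (simp_all add: u_def v_def field_simps)
    note cf = coeff_closed_forms[OF False[unfolded z_def] assms, folded z_def]
    have "coeffR P (Suc k) + coeffR P k = (z * (z * u - v / z) + z * (u - v)) / ((z - 1) * (z + 1))"
      unfolding cf s by (simp add: u_def v_def add_divide_distrib)
    also have "z * (z * u - v / z) + z * (u - v) = (z * u - v) * (z + 1)"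
      using z0 by (simp add: field_simps)
    finally have 1: "coeffA P k = coeffR P (Suc k) + coeffR P k"
      using z2 unfolding cf by (simp add: u_def v_def)
    have "coeffS P (Suc k) - coeffS P k = (z * (z * u - 2 + v / z) - z * (u - 2 + v)) / (z - 1)\<^sup>2"
      unfolding cf s by (simp add: u_def v_def diff_divide_distrib)
    also have "z * (z * u - 2 + v / z) - z * (u - 2 + v) = (z * u - v) * (z - 1)"
      using z0 by (simp add: field_simps)
    finally have "coeffS P (Suc k) - coeffS P k = coeffA P k"
      using z1 unfolding cf by (simp add: u_def v_def power2_eq_square)
    with 1 show ?thesis
      by (simp add: algebra_simps)
  qed
  then show "coeffA P k = coeffR P (Suc k) + coeffR P k"
    and "coeffS P (Suc k) = coeffS P k + coeffA P k"
    by simp_all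
qed

section \<open>Factorisation of the generating matrix\<close>

text \<open>
  The factor \<open>h\<close>, the only place where \<open>P\<close> occurs. Its shape is forced: if the series of \<open>r\<close> and \<open>s\<close>
  are \<open>(1 - t) h\<close> and \<open>(1 + t) h\<close>, then their sum is \<open>2 h\<close>.
\<close>

definition level_factor :: "complex \<Rightarrow> dn fps" where
  "level_factor P = Abs_fps (\<lambda>k. const_dn ((coeffR P k + coeffS P k) / 2))"

lemma one_plus_times_one_minus: "(1 + x) * ((1 - x) * y) = (1 - x\<^sup>2) * y"
  for x y :: "'a::comm_ring_1"
  by (simp add: algebra_simps power2_eq_square)

text \<open>
  Both recurrences together give \<open>r\<^bsub>k+1\<^esub> - s\<^bsub>k+1\<^esub> = - (r\<^sub>k + s\<^sub>k)\<close>, so \<open>r\<^bsub>k+1\<^esub>\<close> and \<open>s\<^bsub>k+1\<^esub>\<close> are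
  the difference and the sum of consecutive coefficients of \<open>h\<close>. The third identity is the recurrence for
  \<open>a\<close>, that is \<open>t a(t) = (1 + t) r(t)\<close>.
\<close>

lemma level_factor_series:
  assumes "exp P \<noteq> - 1"
  shows "Abs_fps (\<lambda>k. const_dn (coeffR P k)) = (1 - fps_X) * level_factor P"
    and "Abs_fps (\<lambda>k. const_dn (coeffS P k)) = (1 + fps_X) * level_factor P"
    and "fps_X * Abs_fps (\<lambda>k. const_dn (coeffA P k)) = (1 - fps_X\<^sup>2) * level_factor P"
proof -
  have minus: "const_dn a - const_dn b = const_dn (a - b)" for a b
    by (simp add: const_dn_def single_diff)
  have "Abs_fps (\<lambda>k. const_dn (coeffR P k)) $ k = ((1 - fps_X) * level_factor P) $ k" for k
  proof (cases k)
    case 0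
    then show ?thesis by (simp add: level_factor_def coeff_initial)
  next
    case (Suc j)
    have "coeffR P (Suc j) = (coeffR P (Suc j) + coeffS P (Suc j)) / 2 - (coeffR P j + coeffS P j) / 2"
      unfolding coeff_recurrence[OF assms] by (simp add: field_simps)
    then show ?thesis
      using Suc by (simp add: level_factor_def left_diff_distrib minus)
  qed
  then show R: "Abs_fps (\<lambda>k. const_dn (coeffR P k)) = (1 - fps_X) * level_factor P"
    by (rule fps_ext)
  have "Abs_fps (\<lambda>k. const_dn (coeffS P k)) $ k = ((1 + fps_X) * level_factor P) $ k" for k
  proof (cases k)
    case 0
    then show ?thesis by (simp add: level_factor_def coeff_initial)
  next
    case (Suc j)
    have "coeffS P (Suc j) = (coeffR P (Suc j) + coeffS P (Suc j)) / 2 + (coeffR P j + coeffS P j) / 2"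
      unfolding coeff_recurrence[OF assms] by (simp add: field_simps)
    then show ?thesis
      using Suc by (simp add: level_factor_def distrib_right flip: const_dn_add)
  qed
  then show "Abs_fps (\<lambda>k. const_dn (coeffS P k)) = (1 + fps_X) * level_factor P"
    by (rule fps_ext)
  have "(fps_X * Abs_fps (\<lambda>k. const_dn (coeffA P k))) $ k =
      ((1 + fps_X) * Abs_fps (\<lambda>k. const_dn (coeffR P k))) $ k" for k
    by (cases k) (simp_all add: distrib_right coeff_initial coeff_recurrence(1)[OF assms] const_dn_add)
  then have "fps_X * Abs_fps (\<lambda>k. const_dn (coeffA P k)) =
      (1 + fps_X) * Abs_fps (\<lambda>k. const_dn (coeffR P k))"
    by (rule fps_ext)
  then show "fps_X * Abs_fps (\<lambda>k. const_dn (coeffA P k)) = (1 - fps_X\<^sup>2) * level_factor P"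
    by (simp only: R one_plus_times_one_minus)
qed

lemma lam_minus_one: "lam (- 1) = fls_X"
  by (simp add: lam_def fls_X_conv_shift_1)

lemma lam_mult: "lam a * lam b = lam (a + b)"
  unfolding lam_def fls_X_intpow_times_fls_X_intpow by simp

lemma lam_0 [simp]: "lam 0 = 1"
  by (simp add: lam_def)

definition order_weight :: "nat \<Rightarrow> nat \<Rightarrow> dn fls" where
  "order_weight a b = (if a < b then 1 else lam (- 1))"

abbreviation dn_kernel :: "(nat \<Rightarrow> nat \<Rightarrow> dn) \<Rightarrow> nat \<Rightarrow> nat \<Rightarrow> dn fls" where
  "dn_kernel \<Gamma> \<equiv> braid_kernel (lam (- 1)) (lam 1) order_weight (\<lambda>a b. fls_const (\<Gamma> a b))"

text \<open>
  Each entry of the generating matrix is \<open>r(t) R + s(t) S + a(t) A - t a(t) A\<^sup>T\<close> with the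
  scalar series of \<open>level_factor_series\<close>. Below the diagonal the common factor \<open>t\<close> appears because
  \<open>1 - t = t (\<lambda> - 1)\<close>.
\<close>

lemma G_series_factorisation:
  assumes "exp P \<noteq> - 1"
  shows "G_series n P = mat1 n (\<lambda>a b. fps_to_fls (level_factor P) * dn_kernel G a b)"
proof -
  define t l :: "dn fls" where "t = lam (- 1)" and "l = lam 1"
  have tl: "t * l = 1"
    by (simp add: t_def l_def lam_mult)
  note cancel = mult_left_cancel_inverse[OF tl]
  define h where "h = fps_to_fls (level_factor P)"
  define fR where "fR = Abs_fps (\<lambda>k. const_dn (coeffR P k))"
  define fS where "fS = Abs_fps (\<lambda>k. const_dn (coeffS P k))"
  define fA where "fA = Abs_fps (\<lambda>k. const_dn (coeffA P k))"
  have X: "fls_X = t"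
    by (simp add: t_def lam_minus_one)
  note series = level_factor_series[OF assms, folded fR_def fS_def fA_def]
  have R: "fps_to_fls fR = (1 - t) * h" and S: "fps_to_fls fS = (1 + t) * h"
    using series by (simp_all add: fls_times_fps_to_fls X h_def)
  have tA: "t * fps_to_fls fA = (1 - t\<^sup>2) * h"
    using arg_cong[OF series(3), of fps_to_fls]
    by (simp add: fls_times_fps_to_fls X h_def fps_to_fls_power)
  have A: "fps_to_fls fA = l * ((1 - t\<^sup>2) * h)"
    using cancel(2)[of "fps_to_fls fA"] unfolding tA ..
  have entry: "index_mat (G_series n P) (i, j) = h * dn_kernel G (i + 1) (j + 1)"
    if ij: "i < n" "j < n" for i j
  proof -
    define a b where "a = i + 1" and "b = j + 1"
    define r where "r = (if b < a then G b a + G a b - G a a * G b b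
      else if a < b then - G b a - G a b + G a a * G b b else 0)"
    define s where "s = G a a * G b b"
    define u where "u = (if a < b then G a b else if a = b then 1 else 0)"
    define u' where "u' = (if b < a then G b a else if b = a then 1 else 0)"
    have level: "index_mat (G_level n P k) (i, j) = (if k = 0 then u else
        const_dn (coeffR P k) * r + const_dn (coeffS P k) * s + const_dn (coeffA P k) * u
        - const_dn (coeffA P (k - 1)) * u')" for k
      using ij by (simp add: G_level_def A_hat_def R_hat_def S_hat_def mat1_def
          a_def b_def r_def s_def u_def u'_def)
    \<comment> \<open>The level \<open>0\<close> fits the same pattern, because \<open>r\<^sub>0 = s\<^sub>0 = 0\<close> and \<open>a\<^sub>0 = 1\<close>, and
        the series \<open>t a(t)\<close> has no constant term.\<close>
    have "Abs_fps (\<lambda>k. index_mat (G_level n P k) (i, j)) $ k =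
        (fR * fps_const r + fS * fps_const s + fA * fps_const u - fps_X * (fA * fps_const u')) $ k" for k
      by (cases k) (simp_all add: level fR_def fS_def fA_def coeff_initial)
    then have "Abs_fps (\<lambda>k. index_mat (G_level n P k) (i, j)) =
        fR * fps_const r + fS * fps_const s + fA * fps_const u - fps_X * (fA * fps_const u')"
      by (rule fps_ext)
    then have "index_mat (G_series n P) (i, j) = fps_to_fls
        (fR * fps_const r + fS * fps_const s + fA * fps_const u - fps_X * (fA * fps_const u'))"
      using ij by (simp add: G_series_def)
    also have "\<dots> = ((1 - t) * h) * fls_const r + ((1 + t) * h) * fls_const s
        + (l * ((1 - t\<^sup>2) * h)) * fls_const u - ((1 - t\<^sup>2) * h) * fls_const u'"
      by (simp add: fls_times_fps_to_fls X R S A tA tl flip: mult.assoc)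
    also have "\<dots> = h * dn_kernel G a b"
    proof -
      define x y g where "x = fls_const (G a b)" and "y = fls_const (G b a)"
        and "g = fls_const (G a a) * fls_const (G b b)"
      have s: "fls_const s = g"
        by (simp add: s_def g_def)
      consider "a = b" | "a < b" | "b < a"
        by linarith
      then show ?thesis
      proof cases
        case 1
        have "h * dn_kernel G a b = h * ((1 + t) * g + (l - 1) * (1 - t\<^sup>2))"
          using 1 by (simp add: braid_kernel_def g_def power2_eq_square t_def l_def)
        then show ?thesis
          using 1 by (simp add: s r_def u_def u'_def algebra_simps)
      next
        case 2
        have r: "fls_const r = g - x - y"
          using 2 by (simp add: r_def x_def y_def g_def fls_minus_const algebra_simps)
        have kernel: "h * dn_kernel G a b = h * (2 * g + (l - 1) * x - (1 - t) * y)"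
          using 2 by (simp add: braid_kernel_def order_weight_def g_def x_def y_def t_def l_def mult.assoc)
        have u: "fls_const u = x" "fls_const u' = 0"
          using 2 by (simp_all add: u_def u'_def x_def)
        show ?thesis
          unfolding s r u kernel by (simp add: algebra_simps power2_eq_square cancel tl)
      next
        case 3
        have r: "fls_const r = x + y - g"
          using 3 by (simp add: r_def x_def y_def g_def fls_plus_const fls_minus_const add.commute)
        have kernel: "h * dn_kernel G a b = h * (t * (2 * g + (l - 1) * x - (1 - t) * y))"
          using 3 by (simp add: braid_kernel_def order_weight_def g_def x_def y_def t_def l_def mult.assoc)
        have u: "fls_const u = 0" "fls_const u' = y"
          using 3 by (simp_all add: u_def u'_def y_def)
        show ?thesis
          unfolding s r u kernel by (simp add: algebra_simps power2_eq_square cancel tl)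
      qed
    qed
    finally show ?thesis
      by (simp add: a_def b_def)
  qed
  show ?thesis
    by (rule eq_matI) (use entry in \<open>simp_all add: mat1_def h_def\<close>, simp_all add: G_series_def)
qed

section \<open>The substitution on scalar series\<close>

text \<open>
  These series are fixed by every substitution. Multiplying a constant by them
  commutes with the coefficientwise action.
\<close>

definition scalar_series :: "dn fls \<Rightarrow> bool" where
  "scalar_series F \<longleftrightarrow> (\<forall>k. \<exists>c. fls_nth F k = const_dn c)"

lemma scalar_series_add: "scalar_series F \<Longrightarrow> scalar_series H \<Longrightarrow> scalar_series (F + H)"
  unfolding scalar_series_def by (metis const_dn_add fls_plus_nth)

lemma scalar_series_diff: "scalar_series F \<Longrightarrow> scalar_series H \<Longrightarrow> scalar_series (F - H)"
  unfolding scalar_series_def by (metis const_dn_def single_diff fls_minus_nth)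

lemma scalar_series_mult:
  assumes "scalar_series F" "scalar_series H"
  shows "scalar_series (F * H)"
proof -
  obtain f h where "\<And>k. fls_nth F k = const_dn (f k)" "\<And>k. fls_nth H k = const_dn (h k)"
    using assms unfolding scalar_series_def by metis
  moreover have "(\<Sum>i\<in>S. const_dn (v i)) = const_dn (sum v S)" for v :: "int \<Rightarrow> complex" and S
    by (induction S rule: infinite_finite_induct) (simp_all add: const_dn_add)
  ultimately show ?thesis
    unfolding scalar_series_def by (auto simp: fls_times_nth(2) simp flip: const_dn_mult)
qed

lemma scalar_series_1: "scalar_series 1"
  unfolding scalar_series_def by (auto intro: exI[of _ 1] exI[of _ 0])

lemma scalar_series_lam: "scalar_series (lam e)"
  unfolding scalar_series_def lam_def by (auto intro: exI[of _ 1] exI[of _ 0])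

lemma scalar_series_level_factor: "scalar_series (fps_to_fls (level_factor P))"
  unfolding scalar_series_def level_factor_def by (auto intro: exI[of _ 0])

lemma map_coeffs_scalar_mult:
  assumes "scalar_series F"
  shows "map_coeffs (subst_dn \<sigma>) (F * fls_const r) = F * fls_const (subst_dn \<sigma> r)"
proof (rule fls_eqI)
  fix k
  obtain c where "fls_nth F k = const_dn c"
    using assms unfolding scalar_series_def by blast
  then show "fls_nth (map_coeffs (subst_dn \<sigma>) (F * fls_const r)) k =
      fls_nth (F * fls_const (subst_dn \<sigma> r)) k"
    by (simp add: nth_map_coeffs subst_dn_mult)
qed

lemma map_coeffs_add:
  "map_coeffs (subst_dn \<sigma>) (F + H) = map_coeffs (subst_dn \<sigma>) F + map_coeffs (subst_dn \<sigma>) H"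
  by (rule fls_eqI) (simp add: nth_map_coeffs subst_dn_add)

text \<open>
  The kernel is a combination of constants \<open>\<Gamma> a a * \<Gamma> b b\<close>, \<open>\<Gamma> a b\<close>, \<open>\<Gamma> b a\<close>, \<open>1\<close> with coefficients
  that are scalar series.
\<close>

lemma map_coeffs_kernel:
  assumes "scalar_series h"
  shows "map_coeffs (subst_dn \<sigma>) (h * dn_kernel G a b) = h * dn_kernel \<sigma> a b"
proof -
  define e where "e = order_weight a b"
  note scalar = scalar_series_add scalar_series_diff scalar_series_mult scalar_series_1
    scalar_series_lam assms
  have e: "scalar_series e"
    by (simp add: e_def order_weight_def scalar)
  have diag: "h * dn_kernel \<Gamma> a b =
      (h * (1 + lam (- 1))) * fls_const (\<Gamma> a a * \<Gamma> a a)
      + (h * ((lam 1 - 1) * (1 - lam (- 1) * lam (- 1)))) * fls_const 1" if "a = b" for \<Gamma>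
    using that by (simp add: braid_kernel_def power2_eq_square algebra_simps flip: fls_const_mult_const)
  have off: "h * dn_kernel \<Gamma> a b =
      (h * (e * (1 + 1))) * fls_const (\<Gamma> a a * \<Gamma> b b)
      + (h * (e * (lam 1 - 1))) * fls_const (\<Gamma> a b)
      + (h * (e * (lam (- 1) - 1))) * fls_const (\<Gamma> b a)" if "a \<noteq> b" for \<Gamma>
    using that by (simp add: braid_kernel_def e_def algebra_simps flip: fls_const_mult_const)
  have one: "subst_dn \<sigma> 1 = 1"
    using subst_dn_const[of \<sigma> 1] by simp
  show ?thesis
  proof (cases "a = b")
    case True
    show ?thesis
      unfolding diag[OF True] map_coeffs_add
      by (simp only: map_coeffs_scalar_mult scalar subst_dn_mult subst_dn_G one)
  next
    case False
    show ?thesis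
      unfolding off[OF False] map_coeffs_add
      by (simp only: map_coeffs_scalar_mult scalar e subst_dn_mult subst_dn_G)
  qed
qed

section \<open>The braid action\<close>

text \<open>
  The generators for \<open>i, i + 1\<close> and for \<open>n, 1\<close> in one statement: by the factorisation it is the ring
  identity for the kernel, taken at the constant series of the variables.
\<close>

lemma braid_act_G_series:
  fixes c d :: "dn fls"
  assumes P: "exp P \<noteq> - 1"
    and range: "p \<in> {1..n}" "q \<in> {1..n}" "p \<noteq> q"
    and cd: "c * d = 1"
    and weights: "order_weight p q = d" "order_weight q p = lam (- 1) * c"
      "\<And>b. b \<in> {1..n} \<Longrightarrow> b \<noteq> p \<Longrightarrow> b \<noteq> q \<Longrightarrow> order_weight q b = c * order_weight p b"
      "\<And>a. a \<in> {1..n} \<Longrightarrow> a \<noteq> p \<Longrightarrow> a \<noteq> q \<Longrightarrow> order_weight a q = d * order_weight a p"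
  shows "braid_act n p q (G_series n P) =
    pair_mat n p q (fls_const (G p q)) c d * G_series n P
      * transpose_mat (pair_mat n p q (fls_const (G p q)) d c)"
proof -
  define h where "h = fps_to_fls (level_factor P)"
  let ?x = "\<lambda>a b. fls_const (G a b)"
  have tl: "lam (- 1) * lam 1 = 1"
    by (simp add: lam_mult)
  have move: "fls_const (braid_image n p q a b) = braid_move p q ?x a b"
    if "a \<in> {1..n}" "b \<in> {1..n}" for a b
  proof -
    have in_range: "(a \<notin> {1..n} \<or> b \<notin> {1..n}) = False"
      using that by blast
    show ?thesis
      unfolding braid_image_def braid_move_def in_range if_False if_distrib[of fls_const]
      by (simp only: fls_const_mult_const[symmetric] fls_plus_const[symmetric]
          fls_minus_const[symmetric] fls_const_power fls_const_numeral)
  qed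
  have "braid_act n p q (G_series n P) =
      mat1 n (\<lambda>a b. map_coeffs (subst_dn (braid_image n p q)) (h * dn_kernel G a b))"
    unfolding braid_act_def G_series_factorisation[OF P] h_def
    by (intro eq_matI) (simp_all add: mat1_def)
  also have "\<dots> = mat1 n (\<lambda>a b. pair_row p q (?x p q) c d
      (\<lambda>a'. pair_row p q (?x p q) d c (\<lambda>b'. h * dn_kernel G a' b') b) a)"
  proof (rule mat1_cong)
    fix a b assume ab: "a \<in> {1..n}" "b \<in> {1..n}"
    show "map_coeffs (subst_dn (braid_image n p q)) (h * dn_kernel G a b) =
      pair_row p q (?x p q) c d (\<lambda>a'. pair_row p q (?x p q) d c (\<lambda>b'. h * dn_kernel G a' b') b) a"
    proof -
      have "dn_kernel (braid_image n p q) a b =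
          braid_kernel (lam (- 1)) (lam 1) order_weight (braid_move p q ?x) a b"
        by (simp only: braid_kernel_def move ab)
      also have "\<dots> = pair_row p q (?x p q) c d (\<lambda>a'. pair_row p q (?x p q) d c (dn_kernel G a') b) a"
        by (rule braid_kernel_braid_move[OF tl cd range(3) weights(1,2), where x = ?x])
          (use ab in \<open>blast intro: weights\<close>)+
      finally show ?thesis
        unfolding map_coeffs_kernel[OF scalar_series_level_factor[of P, folded h_def]]
        by (simp only: pair_row_scale)
    qed
  qed
  also have "\<dots> = pair_mat n p q (?x p q) c d * G_series n P
      * transpose_mat (pair_mat n p q (?x p q) d c)"
    by (simp only: G_series_factorisation[OF P] pair_mat_conjugate[OF range] h_def)
  finally show ?thesis .
qed

theorem theorem7p3:
  fixes n :: nat and P w :: complex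
  assumes "n \<ge> 2"
    and "w = exp (P / 2) + exp (- (P / 2))"
    and "w \<noteq> 0"
  shows "(\<forall>i\<in>{1..n - 1}.
           braid_act n i (i + 1) (G_series n P)
             = B_mat n i * G_series n P * transpose_mat (B_mat n i))
       \<and> braid_act n n 1 (G_series n P)
             = B_cyc n 1 * G_series n P * transpose_mat (B_cyc n (- 1))"
proof -
  \<comment> \<open>The parameter vanishes exactly when \<open>exp P = - 1\<close>.\<close>
  have "exp (P / 2) * w = exp P + 1"
  proof -
    have "exp (P / 2) * w = exp (P / 2 + P / 2) + exp (P / 2 + - (P / 2))"
      by (simp only: assms(2) distrib_left mult_exp_exp)
    then show ?thesis by simp
  qed
  with assms(3) have "exp P \<noteq> - 1"
    by auto
  note act = braid_act_G_series[OF this]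
  show ?thesis
  proof (intro conjI ballI)
    fix i assume i: "i \<in> {1..n - 1}"
    have B: "B_mat n i = pair_mat n i (i + 1) (fls_const (G i (i + 1))) 1 1"
      unfolding B_mat_def pair_mat_def by (rule mat1_cong) (auto simp: pair_entry_def)
    show "braid_act n i (i + 1) (G_series n P)
        = B_mat n i * G_series n P * transpose_mat (B_mat n i)"
      unfolding B by (rule act) (use i in \<open>auto simp: order_weight_def\<close>)
  next
    have B: "B_cyc n e = pair_mat n n 1 (fls_const (G n 1)) (lam e) (lam (- e))" for e
      unfolding B_cyc_def pair_mat_def using assms(1) by (intro mat1_cong) (auto simp: pair_entry_def)
    have "braid_act n n 1 (G_series n P) =
        pair_mat n n 1 (fls_const (G n 1)) (lam 1) (lam (- 1)) * G_series n P
          * transpose_mat (pair_mat n n 1 (fls_const (G n 1)) (lam (- 1)) (lam 1))"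
      by (rule act) (use assms(1) in \<open>auto simp: order_weight_def lam_mult\<close>)
    then show "braid_act n n 1 (G_series n P) = B_cyc n 1 * G_series n P * transpose_mat (B_cyc n (- 1))"
      by (simp add: B)
  qed
qed

end
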